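(* In the single-level reformulation $$\min_{x\in X,\,y\in Y}\; c_u^\top x+d_u^\top y\quad\text{s.t. } A_ux+B_uy\le h_u,\quad A_\ell x+B_\ell y\le h_\ell,\quad d_\ell^\top y\ge\phi(x),$$ with $X=\{0,1\}^{n_x}$, the constraint $d_\ell^\top y\ge\phi(x)$ can be fully described by finitely many of the Lagrangian-based inequalities of any one of the three types below. That is, for each of the three types there is a finite set $\mathcal Z\subseteq\{0,1\}^{n_x}$ such that for all $(x,y)\in X\times Y$ with $A_ux+B_uy\le h_u$ and $A_\ell x+B_\ell y\le h_\ell$, one has $d_\ell^\top y\ge\phi(x)$ if and only if $(x,y)$ satisfies the inequality of that type for every $z\in\mathcal Z$: (P) $d_\ell^\top y\ge\phi(z)-\hat\rho\,(\mathbf 1^\top x+\mathbf 1^\top z-2x^\top z)$; (L) $d_\ell^\top y\ge\phi(z)-\hat\lambda(z)^\top(x-z)$; (A) $d_\ell^\top y\ge\phi(z)-\hat\lambda(z)^\top(x-z)-\hat\rho\,(\mathbf 1^\top x+\mathbf 1^\top z-2x^\top z)$.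
   Context: $Y\subseteq\mathbb{R}^{n_y}$; all matrices and vectors are real of compatible dimensions. $\mathbf 1$ is the all-ones vector, $\odot$ the entrywise product. The value function is $\phi(x)=\max\{d_\ell^\top y' : y'\in Y,\ B_\ell y'\le h_\ell-A_\ell x\}$ for $x\in\{0,1\}^{n_x}$, equal to $-\infty$ when infeasible and real-valued (attained) otherwise. $X_{LF}=\{x\in\{0,1\}^{n_x}:\exists y'\in Y,\ B_\ell y'\le h_\ell-A_\ell x\}$. $\psi:[0,1]^{n_x}\to\mathbb{R}\cup\{-\infty\}$ is the extension of $\phi$ that is affine in each individual coordinate, $\psi(z)=\sum_{x\in\{0,1\}^{n_x}}\phi(x)\prod_{i:x_i=1}z_i\prod_{i:x_i=0}(1-z_i)$, with $0\cdot(-\infty)=0$. Define, for $x\in\{0,1\}^{n_x}$, $\lambda\in\mathbb{R}^{n_x}$, $\rho\ge0$, $L_p(x,\rho)=\max_{z\in[0,1]^{n_x}}\psi(z)-\rho(\mathbf 1^\top x+\mathbf 1^\top z-2x^\top z)$, $L_\ell(x,\lambda)=\max_{z\in[0,1]^{n_x}}\psi(z)-\lambda^\top(x-z)$, $L_a(x,\lambda,\rho)=\max_{z\in[0,1]^{n_x}}\psi(z)-\lambda^\top(x-z)-\rho(\mathbf 1^\top x+\mathbf 1^\top z-2x^\top z)$. $\hat\lambda(z)=U\odot(\mathbf 1-z)+L\odot z$. The constants (chosen separately for each type) $\hat\rho\ge0$, $U,L\in\mathbb{R}^{n_x}$ are such that: for (P): $L_p(x,\rho)=\phi(x)$ for all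 $x\in X_{LF}$ and $\rho\ge\hat\rho$; for (L): $L_\ell(x,\lambda)=\phi(x)$ for all $x\in X_{LF}$ and all $\lambda$ with $\lambda_i\ge U_i$ if $x_i=1$ and $\lambda_i\le L_i$ if $x_i=0$; for (A): $L_a(x,\lambda,\rho)=\phi(x)$ for all $x\in X_{LF}$, all $\rho\ge\hat\rho$ and all $\lambda$ with $\lambda_i\ge U_i$ if $x_i=1$ and $\lambda_i\le L_i$ if $x_i=0$. *)

theory Defs
  imports "HOL-Analysis.Analysis"
begin

text \<open>Vectors carry the componentwise order and product, so \<open>\<le>\<close> and \<open>*\<close> on \<open>real ^ 'n\<close> are
  entrywise, \<open>1\<close> is the all-ones vector and \<open>{0..1}\<close> is the unit cube.\<close>

definition binary_vecs :: "(real ^ 'n) set" where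
  "binary_vecs = {x. \<forall>i. x $ i = 0 \<or> x $ i = 1}"

definition lower_feasible ::
  "(real ^ 'm) set \<Rightarrow> real ^ 'n ^ 'k \<Rightarrow> real ^ 'm ^ 'k \<Rightarrow> real ^ 'k \<Rightarrow> real ^ 'n \<Rightarrow> (real ^ 'm) set"
  where
  "lower_feasible Y A\<^sub>l B\<^sub>l h\<^sub>l x = {y \<in> Y. B\<^sub>l *v y \<le> h\<^sub>l - A\<^sub>l *v x}"

definition X_LF ::
  "(real ^ 'm) set \<Rightarrow> real ^ 'n ^ 'k \<Rightarrow> real ^ 'm ^ 'k \<Rightarrow> real ^ 'k \<Rightarrow> (real ^ 'n) set" where
  "X_LF Y A\<^sub>l B\<^sub>l h\<^sub>l = {x \<in> binary_vecs. \<exists>y. y \<in> lower_feasible Y A\<^sub>l B\<^sub>l h\<^sub>l x}"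

text \<open>The supremum over the empty set is \<open>-\<infinity>\<close>. On \<open>X_LF\<close> the supremum is the maximum whenever the
  latter exists; that it does is the separate condition \<open>lower_attained\<close>.\<close>

definition value_fun ::
  "(real ^ 'm) set \<Rightarrow> real ^ 'n ^ 'k \<Rightarrow> real ^ 'm ^ 'k \<Rightarrow> real ^ 'k \<Rightarrow> real ^ 'm \<Rightarrow> real ^ 'n \<Rightarrow> ereal"
  where
  "value_fun Y A\<^sub>l B\<^sub>l h\<^sub>l d\<^sub>l x = (SUP y \<in> lower_feasible Y A\<^sub>l B\<^sub>l h\<^sub>l x. ereal (d\<^sub>l \<bullet> y))"

definition lower_attained ::
  "(real ^ 'm) set \<Rightarrow> real ^ 'n ^ 'k \<Rightarrow> real ^ 'm ^ 'k \<Rightarrow> real ^ 'k \<Rightarrow> real ^ 'm \<Rightarrow> bool" where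
  "lower_attained Y A\<^sub>l B\<^sub>l h\<^sub>l d\<^sub>l \<longleftrightarrow>
    (\<forall>x \<in> X_LF Y A\<^sub>l B\<^sub>l h\<^sub>l. \<exists>y \<in> lower_feasible Y A\<^sub>l B\<^sub>l h\<^sub>l x.
       \<forall>y' \<in> lower_feasible Y A\<^sub>l B\<^sub>l h\<^sub>l x. d\<^sub>l \<bullet> y' \<le> d\<^sub>l \<bullet> y)"

text \<open>The extension that is affine in each coordinate. In \<^typ>\<open>ereal\<close>, \<open>0 * (-\<infinity>) = 0\<close>.\<close>

definition multiaffine_ext :: "(real ^ 'n \<Rightarrow> ereal) \<Rightarrow> real ^ 'n \<Rightarrow> ereal" where
  "multiaffine_ext f z = (\<Sum>x \<in> binary_vecs.
     f x * ereal ((\<Prod>i \<in> {i. x $ i = 1}. z $ i) * (\<Prod>i \<in> {i. x $ i = 0}. 1 - z $ i)))"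

definition pen :: "real ^ 'n \<Rightarrow> real ^ 'n \<Rightarrow> real" where
  "pen x z = 1 \<bullet> x + 1 \<bullet> z - 2 * (x \<bullet> z)"

text \<open>The maxima over the cube are written as suprema in \<^typ>\<open>ereal\<close>. For binary \<open>x\<close>, the objectives
  below take the value \<open>f x\<close> at \<open>z = x\<close> (see \<open>multiaffine_ext_binary\<close> and \<open>pen_self\<close>), so if a
  supremum equals \<open>f x\<close>, it is attained there.\<close>

definition Lag_p :: "(real ^ 'n \<Rightarrow> ereal) \<Rightarrow> real ^ 'n \<Rightarrow> real \<Rightarrow> ereal" where
  "Lag_p f x \<rho> = (SUP z \<in> {0..1}. multiaffine_ext f z - ereal (\<rho> * pen x z))"

definition Lag_l :: "(real ^ 'n \<Rightarrow> ereal) \<Rightarrow> real ^ 'n \<Rightarrow> real ^ 'n \<Rightarrow> ereal" where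
  "Lag_l f x lam = (SUP z \<in> {0..1}. multiaffine_ext f z - ereal (lam \<bullet> (x - z)))"

definition Lag_a :: "(real ^ 'n \<Rightarrow> ereal) \<Rightarrow> real ^ 'n \<Rightarrow> real ^ 'n \<Rightarrow> real \<Rightarrow> ereal" where
  "Lag_a f x lam \<rho> =
     (SUP z \<in> {0..1}. multiaffine_ext f z - ereal (lam \<bullet> (x - z)) - ereal (\<rho> * pen x z))"

definition mult_bounds :: "real ^ 'n \<Rightarrow> real ^ 'n \<Rightarrow> real ^ 'n \<Rightarrow> real ^ 'n \<Rightarrow> bool" where
  "mult_bounds U L x lam \<longleftrightarrow>
     (\<forall>i. (x $ i = 1 \<longrightarrow> lam $ i \<ge> U $ i) \<and> (x $ i = 0 \<longrightarrow> lam $ i \<le> L $ i))"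

definition lam_hat :: "real ^ 'n \<Rightarrow> real ^ 'n \<Rightarrow> real ^ 'n \<Rightarrow> real ^ 'n" where
  "lam_hat U L z = U * (1 - z) + L * z"

lemma finite_binary_vecs: "finite (binary_vecs :: (real ^ 'n) set)"
proof -
  have "(binary_vecs :: (real ^ 'n) set) \<subseteq> (\<lambda>S. \<chi> i. if i \<in> S then 1 else 0) ` UNIV"
  proof
    fix x :: "real ^ 'n"
    assume "x \<in> binary_vecs"
    then have "x = (\<chi> i. if i \<in> {i. x $ i = 1} then 1 else 0)"
      by (auto simp: binary_vecs_def vec_eq_iff)
    then show "x \<in> (\<lambda>S. \<chi> i. if i \<in> S then 1 else 0) ` UNIV" by blast
  qed
  then show ?thesis by (rule finite_subset) simp
qed

lemma multiaffine_ext_binary: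
  fixes z :: "real ^ 'n"
  assumes z: "z \<in> binary_vecs"
  shows "multiaffine_ext f z = f z"
proof -
  have w: "(\<Prod>i \<in> {i. x $ i = 1}. z $ i) * (\<Prod>i \<in> {i. x $ i = 0}. 1 - z $ i)
      = (if x = z then 1 else 0)" if x: "x \<in> binary_vecs" for x :: "real ^ 'n"
  proof (cases "x = z")
    case True
    then show ?thesis by simp
  next
    case False
    then obtain i where i: "x $ i \<noteq> z $ i" by (auto simp: vec_eq_iff)
    have "(x $ i = 1 \<and> z $ i = 0) \<or> (x $ i = 0 \<and> z $ i = 1)"
      using i x z by (auto simp: binary_vecs_def) metis+
    then show ?thesis using False by (auto intro!: prod_zero)
  qed
  have "multiaffine_ext f z = (\<Sum>x \<in> binary_vecs. if x = z then f x else 0)"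
    unfolding multiaffine_ext_def by (rule sum.cong) (auto simp: w one_ereal_def[symmetric] zero_ereal_def[symmetric])
  also have "\<dots> = f z" using z by (simp add: finite_binary_vecs)
  finally show ?thesis .
qed

lemma pen_self:
  assumes "x \<in> binary_vecs"
  shows "pen x x = 0"
proof -
  have "x \<bullet> x = 1 \<bullet> x"
    unfolding inner_vec_def using assms by (intro sum.cong) (auto simp: binary_vecs_def)
  then show ?thesis by (simp add: pen_def)
qed

end

theory Submission
  imports Defs
begin

text \<open>Take \<open>Z = {0,1}\<^sup>n\<close>. The inequality for \<open>z = x\<close> is \<open>d\<^sub>l \<bullet> y \<ge> \<phi> x\<close> itself. Conversely, a
  Lagrangian that equals \<open>\<phi> x\<close> bounds its objective at every binary \<open>z\<close>, where \<open>\<psi> z = \<phi> z\<close>. The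
  multiplier of the inequality depends on \<open>z\<close>, that of the Lagrangian on \<open>x\<close>, but \<open>\<lambda> \<bullet> (x - z)\<close> only
  sees the coordinates in which \<open>x\<close> and \<open>z\<close> differ, and there \<open>\<lambda>\<close> of \<open>z\<close> agrees with \<open>\<lambda>\<close> of the
  complement \<open>1 - x\<close>, which is admissible for \<open>x\<close>.\<close>

lemma binary_vecs_subset_cube: "binary_vecs \<subseteq> {0..1 :: real ^ 'n}"
proof
  fix z :: "real ^ 'n"
  assume "z \<in> binary_vecs"
  then have "0 \<le> z $ i \<and> z $ i \<le> 1" for i
    by (auto simp: binary_vecs_def dest: spec[of _ i])
  then show "z \<in> {0..1}" by (simp add: less_eq_vec_def)
qed

text \<open>Where \<open>x\<close> is 1 the complement is 0 and \<open>lam_hat\<close> selects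
  \<open>U\<close>; where \<open>x\<close> is 0 it selects \<open>L\<close>. Each required bound
  thus holds with equality.\<close>

lemma mult_bounds_lam_hat_complement:
  assumes "x \<in> binary_vecs"
  shows "mult_bounds U L x (lam_hat U L (1 - x))"
  using assms by (simp add: mult_bounds_def lam_hat_def)

lemma lam_hat_complement_inner:
  assumes x: "x \<in> binary_vecs" and z: "z \<in> binary_vecs"
  shows "lam_hat U L (1 - x) \<bullet> (x - z) = lam_hat U L z \<bullet> (x - z)"
proof -
  have "lam_hat U L (1 - x) $ i * (x - z) $ i = lam_hat U L z $ i * (x - z) $ i" for i
  proof -
    have "x $ i = 0 \<or> x $ i = 1" "z $ i = 0 \<or> z $ i = 1"
      using x z by (auto simp: binary_vecs_def)
    then show ?thesis by (auto simp: lam_hat_def)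
  qed
  then show ?thesis unfolding inner_vec_def inner_real_def by (rule sum.cong[OF refl])
qed

text \<open>The point \<open>z\<close> lies in the cube over which the supremum runs, and the
  multiaffine extension agrees with \<open>f\<close> there. The next two bounds hold for the same
  reason.\<close>

lemma Lag_p_ge:
  assumes z: "z \<in> binary_vecs"
  shows "f z - ereal (\<rho> * pen x z) \<le> Lag_p f x \<rho>"
  unfolding Lag_p_def
  by (rule SUP_upper2[of z]) (use z binary_vecs_subset_cube in \<open>auto simp: multiaffine_ext_binary\<close>)

lemma Lag_l_ge:
  assumes z: "z \<in> binary_vecs"
  shows "f z - ereal (lam \<bullet> (x - z)) \<le> Lag_l f x lam"
  unfolding Lag_l_def
  by (rule SUP_upper2[of z]) (use z binary_vecs_subset_cube in \<open>auto simp: multiaffine_ext_binary\<close>)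

lemma Lag_a_ge:
  assumes z: "z \<in> binary_vecs"
  shows "f z - ereal (lam \<bullet> (x - z)) - ereal (\<rho> * pen x z) \<le> Lag_a f x lam \<rho>"
  unfolding Lag_a_def
  by (rule SUP_upper2[of z]) (use z binary_vecs_subset_cube in \<open>auto simp: multiaffine_ext_binary\<close>)

text \<open>The vector \<open>y\<close> is itself a lower-level response to \<open>x\<close>. Hence
  the Lagrangian identities, assumed only on \<open>X_LF\<close>, apply at every \<open>x\<close>
  that the reformulation admits.\<close>

lemma X_LF_I:
  assumes "x \<in> binary_vecs" "y \<in> Y" "A\<^sub>l *v x + B\<^sub>l *v y \<le> h\<^sub>l"
  shows "x \<in> X_LF Y A\<^sub>l B\<^sub>l h\<^sub>l"
  using assms by (auto simp: X_LF_def lower_feasible_def less_eq_vec_def algebra_simps)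

text \<open>Common core of the three types: \<open>g x z\<close> stands for the right-hand side of
  the inequality generated by \<open>z\<close>, evaluated at \<open>x\<close>.\<close>

lemma finite_cut_description:
  fixes g :: "real ^ 'n \<Rightarrow> real ^ 'n \<Rightarrow> ereal"
    and A\<^sub>u :: "real ^ 'n ^ 'j" and B\<^sub>u :: "real ^ 'm ^ 'j"
    and A\<^sub>l :: "real ^ 'n ^ 'k" and B\<^sub>l :: "real ^ 'm ^ 'k"
  assumes tight: "\<And>x. x \<in> binary_vecs \<Longrightarrow> g x x = \<phi> x"
    and valid: "\<And>x z. x \<in> X_LF Y A\<^sub>l B\<^sub>l h\<^sub>l \<Longrightarrow> z \<in> binary_vecs \<Longrightarrow> g x z \<le> \<phi> x"
  shows "\<exists>Z \<subseteq> binary_vecs. finite Z \<and>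
          (\<forall>x \<in> binary_vecs. \<forall>y \<in> Y.
             A\<^sub>u *v x + B\<^sub>u *v y \<le> h\<^sub>u \<longrightarrow> A\<^sub>l *v x + B\<^sub>l *v y \<le> h\<^sub>l \<longrightarrow>
             (ereal (d\<^sub>l \<bullet> y) \<ge> \<phi> x \<longleftrightarrow> (\<forall>z \<in> Z. ereal (d\<^sub>l \<bullet> y) \<ge> g x z)))"
proof (intro exI[of _ binary_vecs] conjI ballI impI subset_refl finite_binary_vecs)
  fix x y
  assume x: "x \<in> binary_vecs" and "y \<in> Y" "A\<^sub>l *v x + B\<^sub>l *v y \<le> h\<^sub>l"
  then have "x \<in> X_LF Y A\<^sub>l B\<^sub>l h\<^sub>l" by (rule X_LF_I)
  \<comment> \<open>Left to right chains with \<open>valid\<close>; right to left instantiates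
    \<open>z\<close> with \<open>x\<close> and uses \<open>tight\<close>.\<close>
  then show "ereal (d\<^sub>l \<bullet> y) \<ge> \<phi> x \<longleftrightarrow> (\<forall>z \<in> binary_vecs. ereal (d\<^sub>l \<bullet> y) \<ge> g x z)"
    using valid tight[OF x] x by (metis order_trans)
qed

theorem corollary4:
  fixes Y :: "(real ^ 'm) set"
    and A\<^sub>u :: "real ^ 'n ^ 'j" and B\<^sub>u :: "real ^ 'm ^ 'j" and h\<^sub>u :: "real ^ 'j"
    and A\<^sub>l :: "real ^ 'n ^ 'k" and B\<^sub>l :: "real ^ 'm ^ 'k" and h\<^sub>l :: "real ^ 'k"
    and d\<^sub>l :: "real ^ 'm"
    and \<phi> :: "real ^ 'n \<Rightarrow> ereal"
  assumes attained: "lower_attained Y A\<^sub>l B\<^sub>l h\<^sub>l d\<^sub>l"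
    and phi: "\<phi> = value_fun Y A\<^sub>l B\<^sub>l h\<^sub>l d\<^sub>l"
  shows
    "(\<forall>\<rho>. \<rho> \<ge> 0 \<longrightarrow>
        (\<forall>x \<in> X_LF Y A\<^sub>l B\<^sub>l h\<^sub>l. \<forall>\<rho>' \<ge> \<rho>. Lag_p \<phi> x \<rho>' = \<phi> x) \<longrightarrow>
        (\<exists>Z \<subseteq> binary_vecs. finite Z \<and>
          (\<forall>x \<in> binary_vecs. \<forall>y \<in> Y.
             A\<^sub>u *v x + B\<^sub>u *v y \<le> h\<^sub>u \<longrightarrow> A\<^sub>l *v x + B\<^sub>l *v y \<le> h\<^sub>l \<longrightarrow>
             (ereal (d\<^sub>l \<bullet> y) \<ge> \<phi> x \<longleftrightarrow>
              (\<forall>z \<in> Z. ereal (d\<^sub>l \<bullet> y) \<ge> \<phi> z - ereal (\<rho> * pen x z))))))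
     \<and>
     (\<forall>U L.
        (\<forall>x \<in> X_LF Y A\<^sub>l B\<^sub>l h\<^sub>l. \<forall>lam. mult_bounds U L x lam \<longrightarrow> Lag_l \<phi> x lam = \<phi> x) \<longrightarrow>
        (\<exists>Z \<subseteq> binary_vecs. finite Z \<and>
          (\<forall>x \<in> binary_vecs. \<forall>y \<in> Y.
             A\<^sub>u *v x + B\<^sub>u *v y \<le> h\<^sub>u \<longrightarrow> A\<^sub>l *v x + B\<^sub>l *v y \<le> h\<^sub>l \<longrightarrow>
             (ereal (d\<^sub>l \<bullet> y) \<ge> \<phi> x \<longleftrightarrow>
              (\<forall>z \<in> Z. ereal (d\<^sub>l \<bullet> y) \<ge> \<phi> z - ereal (lam_hat U L z \<bullet> (x - z)))))))
     \<and>
     (\<forall>\<rho> U L. \<rho> \<ge> 0 \<longrightarrow>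
        (\<forall>x \<in> X_LF Y A\<^sub>l B\<^sub>l h\<^sub>l. \<forall>\<rho>' \<ge> \<rho>. \<forall>lam.
           mult_bounds U L x lam \<longrightarrow> Lag_a \<phi> x lam \<rho>' = \<phi> x) \<longrightarrow>
        (\<exists>Z \<subseteq> binary_vecs. finite Z \<and>
          (\<forall>x \<in> binary_vecs. \<forall>y \<in> Y.
             A\<^sub>u *v x + B\<^sub>u *v y \<le> h\<^sub>u \<longrightarrow> A\<^sub>l *v x + B\<^sub>l *v y \<le> h\<^sub>l \<longrightarrow>
             (ereal (d\<^sub>l \<bullet> y) \<ge> \<phi> x \<longleftrightarrow>
              (\<forall>z \<in> Z. ereal (d\<^sub>l \<bullet> y) \<ge>
                 \<phi> z - ereal (lam_hat U L z \<bullet> (x - z)) - ereal (\<rho> * pen x z))))))"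
proof (intro conjI allI impI)
  fix \<rho> :: real
  assume lag: "\<forall>x \<in> X_LF Y A\<^sub>l B\<^sub>l h\<^sub>l. \<forall>\<rho>' \<ge> \<rho>. Lag_p \<phi> x \<rho>' = \<phi> x"
  show "\<exists>Z \<subseteq> binary_vecs. finite Z \<and>
          (\<forall>x \<in> binary_vecs. \<forall>y \<in> Y.
             A\<^sub>u *v x + B\<^sub>u *v y \<le> h\<^sub>u \<longrightarrow> A\<^sub>l *v x + B\<^sub>l *v y \<le> h\<^sub>l \<longrightarrow>
             (ereal (d\<^sub>l \<bullet> y) \<ge> \<phi> x \<longleftrightarrow>
              (\<forall>z \<in> Z. ereal (d\<^sub>l \<bullet> y) \<ge> \<phi> z - ereal (\<rho> * pen x z))))"
  proof (rule finite_cut_description)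
    fix x z :: "real ^ 'n"
    assume "x \<in> X_LF Y A\<^sub>l B\<^sub>l h\<^sub>l" and z: "z \<in> binary_vecs"
    \<comment> \<open>The threshold \<open>\<rho>\<close> is itself an admissible penalty. If
      \<open>z\<close> is infeasible, \<open>\<phi> z\<close> is -\<infinity> and its inequality is
      vacuous.\<close>
    then have "Lag_p \<phi> x \<rho> = \<phi> x" using lag by simp
    then show "\<phi> z - ereal (\<rho> * pen x z) \<le> \<phi> x" using Lag_p_ge[OF z] by metis
  qed (simp add: pen_self flip: zero_ereal_def)
next
  fix U L :: "real ^ 'n"
  assume lag: "\<forall>x \<in> X_LF Y A\<^sub>l B\<^sub>l h\<^sub>l. \<forall>lam. mult_bounds U L x lam \<longrightarrow> Lag_l \<phi> x lam = \<phi> x"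
  show "\<exists>Z \<subseteq> binary_vecs. finite Z \<and>
          (\<forall>x \<in> binary_vecs. \<forall>y \<in> Y.
             A\<^sub>u *v x + B\<^sub>u *v y \<le> h\<^sub>u \<longrightarrow> A\<^sub>l *v x + B\<^sub>l *v y \<le> h\<^sub>l \<longrightarrow>
             (ereal (d\<^sub>l \<bullet> y) \<ge> \<phi> x \<longleftrightarrow>
              (\<forall>z \<in> Z. ereal (d\<^sub>l \<bullet> y) \<ge> \<phi> z - ereal (lam_hat U L z \<bullet> (x - z)))))"
  proof (rule finite_cut_description)
    fix x z :: "real ^ 'n"
    assume X: "x \<in> X_LF Y A\<^sub>l B\<^sub>l h\<^sub>l" and z: "z \<in> binary_vecs"
    then have x: "x \<in> binary_vecs" by (simp add: X_LF_def)
    \<comment> \<open>Using \<open>lam_hat U L z\<close> directly could break the bounds where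
      \<open>x\<close> and \<open>z\<close> agree: if both are 1 it gives \<open>L\<close>, while at
      least \<open>U\<close> is required.\<close>
    have "Lag_l \<phi> x (lam_hat U L (1 - x)) = \<phi> x"
      using lag X mult_bounds_lam_hat_complement[OF x] by blast
    then show "\<phi> z - ereal (lam_hat U L z \<bullet> (x - z)) \<le> \<phi> x"
      using Lag_l_ge[OF z] lam_hat_complement_inner[OF x z] by metis
  qed (simp flip: zero_ereal_def)
next
  fix \<rho> :: real and U L :: "real ^ 'n"
  assume lag: "\<forall>x \<in> X_LF Y A\<^sub>l B\<^sub>l h\<^sub>l. \<forall>\<rho>' \<ge> \<rho>. \<forall>lam.
           mult_bounds U L x lam \<longrightarrow> Lag_a \<phi> x lam \<rho>' = \<phi> x"
  show "\<exists>Z \<subseteq> binary_vecs. finite Z \<and>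
          (\<forall>x \<in> binary_vecs. \<forall>y \<in> Y.
             A\<^sub>u *v x + B\<^sub>u *v y \<le> h\<^sub>u \<longrightarrow> A\<^sub>l *v x + B\<^sub>l *v y \<le> h\<^sub>l \<longrightarrow>
             (ereal (d\<^sub>l \<bullet> y) \<ge> \<phi> x \<longleftrightarrow>
              (\<forall>z \<in> Z. ereal (d\<^sub>l \<bullet> y) \<ge>
                 \<phi> z - ereal (lam_hat U L z \<bullet> (x - z)) - ereal (\<rho> * pen x z))))"
  proof (rule finite_cut_description)
    fix x z :: "real ^ 'n"
    assume X: "x \<in> X_LF Y A\<^sub>l B\<^sub>l h\<^sub>l" and z: "z \<in> binary_vecs"
    then have x: "x \<in> binary_vecs" by (simp add: X_LF_def)
    \<comment> \<open>The complement multiplier is combined with the threshold penalty; only the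
      linear term has to be rewritten afterwards, since the penalty term already has the form of the
      inequality.\<close>
    have "Lag_a \<phi> x (lam_hat U L (1 - x)) \<rho> = \<phi> x"
      using lag X mult_bounds_lam_hat_complement[OF x] by blast
    then show "\<phi> z - ereal (lam_hat U L z \<bullet> (x - z)) - ereal (\<rho> * pen x z) \<le> \<phi> x"
      using Lag_a_ge[OF z] lam_hat_complement_inner[OF x z] by metis
  \<comment> \<open>Tightness remains: at \<open>z = x\<close> both the linear term and the penalty
    vanish.\<close>
  qed (simp add: pen_self flip: zero_ereal_def)
qed

end
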